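(* Let $G=(V,E,w)$ be a strongly connected weighted digraph with unweighted diameter $d$ and weights in $[-w_{\max},w_{\max}]$, and let $\tilde\varepsilon>0$. If $P\in\Delta_E$ is $\tilde\varepsilon$-suboptimal for the problem $$\min_{P\in\Delta_E}\ \langle P,W\rangle+3dw_{\max}\|P\mathbf{1}-P^T\mathbf{1}\|_1,$$ then $\langle P,W\rangle\le\mu(G)+\tilde\varepsilon$ and $\|P\mathbf{1}-P^T\mathbf{1}\|_1\le\tilde\varepsilon/(dw_{\max})$.
   Context: Vertices are identified with $[n]$. $W_{ij}=w(i,j)$ for $(i,j)\in E$, $\langle P,W\rangle=\sum_{(i,j)\in E}P_{ij}W_{ij}$, $\Delta_E=\{P\in\mathbb{R}_{\ge0}^{n\times n}:\sum_{ij}P_{ij}=1,\ \mathrm{supp}(P)\subseteq E\}$, $\mathbf{1}$ is the all-ones vector. $\tilde\varepsilon$-suboptimal means the objective value at $P$ is at most the optimal value plus $\tilde\varepsilon$. $\mu(G)$ is the minimum over directed cycles $\sigma$ of $\frac1{|\sigma|}\sum_{e\in\sigma}w(e)$; $d$ is the maximum over ordered vertex pairs of the number of edges on a shortest directed path. *)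

theory Defs
  imports
    "HOL-Analysis.Analysis"
    "Graph_Theory.Pair_Digraph"
    "Graph_Theory.Digraph_Component"
    "Graph_Theory.Weighted_Graph"
begin

text \<open>
  The vertex set \<open>[n]\<close> is the universe of a finite index type \<open>'n\<close>, so that \<open>n \<times> n\<close>
  matrices are \<open>real ^ 'n ^ 'n\<close>. An edge set is a relation on \<open>'n\<close>; loops are allowed, and
  count as directed cycles of length 1.
\<close>

definition digraph_of :: "('n \<times> 'n) set \<Rightarrow> ('n, 'n \<times> 'n) pre_digraph" where
  "digraph_of E = with_proj \<lparr> pverts = UNIV, parcs = E \<rparr>"

definition path_dist :: "('n \<times> 'n) set \<Rightarrow> 'n \<Rightarrow> 'n \<Rightarrow> nat" where
  "path_dist E u v = (LEAST k. \<exists>p. pre_digraph.apath (digraph_of E) u p v \<and> length p = k)"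

definition unweighted_diameter :: "('n::finite \<times> 'n) set \<Rightarrow> nat" where
  "unweighted_diameter E = Max {path_dist E u v | u v. True}"

text \<open>
  The library's \<open>cycle\<close> is a nonempty closed walk without repeated vertices, given as the list
  of its edges; there are only finitely many of these.
\<close>

definition min_mean_cycle :: "('n::finite \<times> 'n) set \<Rightarrow> ('n \<times> 'n) weight_fun \<Rightarrow> real" where
  "min_mean_cycle E w =
     Min {sum_list (map w \<sigma>) / real (length \<sigma>) | \<sigma>. pre_digraph.cycle (digraph_of E) \<sigma>}"

definition edge_simplex :: "('n::finite \<times> 'n) set \<Rightarrow> (real ^ 'n ^ 'n) set" where
  "edge_simplex E =
     {P. (\<forall>i j. P $ i $ j \<ge> 0) \<and> (\<Sum>i\<in>UNIV. \<Sum>j\<in>UNIV. P $ i $ j) = 1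
         \<and> {(i, j). P $ i $ j \<noteq> 0} \<subseteq> E}"

definition edge_pairing ::
    "('n::finite \<times> 'n) set \<Rightarrow> ('n \<times> 'n) weight_fun \<Rightarrow> real ^ 'n ^ 'n \<Rightarrow> real" where
  "edge_pairing E w P = (\<Sum>(i, j)\<in>E. P $ i $ j * w (i, j))"

definition l1_norm :: "real ^ 'n::finite \<Rightarrow> real" where
  "l1_norm x = (\<Sum>i\<in>UNIV. \<bar>x $ i\<bar>)"

text \<open>Here \<open>1 :: real ^ 'n\<close> is the all-ones vector.\<close>

definition imbalance :: "real ^ 'n ^ 'n::finite \<Rightarrow> real" where
  "imbalance P = l1_norm (P *v 1 - transpose P *v 1)"

definition penalized_objective ::
    "('n::finite \<times> 'n) set \<Rightarrow> ('n \<times> 'n) weight_fun \<Rightarrow> real \<Rightarrow> real ^ 'n ^ 'n \<Rightarrow> real" where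
  "penalized_objective E w w_max P =
     edge_pairing E w P + 3 * real (unweighted_diameter E) * w_max * imbalance P"

text \<open>
  The optimal value is written as an infimum. For \<open>S = edge_simplex E\<close>, which is compact, and a
  continuous objective, it is the minimum.
\<close>

definition suboptimal :: "'a set \<Rightarrow> ('a \<Rightarrow> real) \<Rightarrow> real \<Rightarrow> 'a \<Rightarrow> bool" where
  "suboptimal S f eps x \<longleftrightarrow> x \<in> S \<and> f x \<le> (INF y\<in>S. f y) + eps"

end

theory Submission
  imports Defs "Graph_Theory.Shortest_Path"
begin

text \<open>
  The value at the normalised edge counts of an optimal cycle shows that the penalised optimum is
  at most \<open>\<mu>(G)\<close>, which already gives the first claim. For the second, reduce all weights by
  \<open>\<mu>(G)\<close>. No cycle is then negative, so the distances from a root form a potential \<open>\<pi>\<close> with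
  \<open>w(i,j) - \<mu>(G) \<ge> \<pi>(j) - \<pi>(i)\<close>, and walking along shortest edge paths shows that \<open>\<pi>\<close>
  oscillates by at most \<open>2 d w\<^sub>m\<^sub>a\<^sub>x\<close>. Summing against \<open>P\<close> gives
  \<open>\<langle>P,W\<rangle> \<ge> \<mu>(G) - 2 d w\<^sub>m\<^sub>a\<^sub>x \<parallel>P\<one> - P\<^sup>T\<one>\<parallel>\<^sub>1\<close>, so a third of the penalty is left over to be bounded
  by \<open>\<epsilon>\<close>.
\<close>

section \<open>Potentials in digraphs without negative cycles\<close>

lemma (in wf_digraph) closed_awalk_cost_nonneg:
  assumes cycles: "\<And>c. cycle c \<Longrightarrow> awalk_cost f c \<ge> 0"
    and "awalk u p u"
  shows "awalk_cost f p \<ge> 0"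
  using assms(2)
proof (induction "length p" arbitrary: u p rule: less_induct)
  case less
  show ?case
  proof (cases "p = [] \<or> distinct (tl (awalk_verts u p))")
    case True
    then show ?thesis
      using cycles less.prems by (cases "p = []") (auto simp: cycle_def)
  next
    case False
    then obtain e es where p: "p = e # es" by (cases p) auto
    \<comment> \<open>Cutting out the closed subwalk \<open>r\<close> between two visits of a vertex
      leaves two closed walks whose costs add up to that of \<open>p\<close>. Setting
      \<open>e\<close> aside first makes \<open>r\<close> strictly shorter than \<open>p\<close>,
      even if \<open>r\<close> is all of \<open>es\<close>.\<close>
    have es: "awalk (head G e) es u" "\<not> distinct (awalk_verts (head G e) es)"
      using less.prems False p by (auto simp: awalk_Cons_iff)
    obtain q r s v where split: "es = q @ r @ s" "0 < length r"
      and walks: "awalk (head G e) q v" "awalk v r v" "awalk v s u"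
      using awalk_not_distinct_decomp[OF es] by blast
    have "awalk u (e # q @ s) u"
      using less.prems p awalk_appendI[OF walks(1,3)] by (auto simp: awalk_Cons_iff)
    then have "awalk_cost f (e # q @ s) \<ge> 0"
      using less.hyps[of "e # q @ s" u] split p by simp
    moreover have "awalk_cost f r \<ge> 0"
      using less.hyps[of r v] walks split p by simp
    ultimately show ?thesis using p split by simp
  qed
qed

text \<open>The potential is the distance from a root, and the inequality is the triangle
  inequality. It is stated for walks, so that it serves both single edges and the long paths that
  bound the oscillation.\<close>

lemma (in fin_digraph) feasible_potential:
  assumes sc: "strongly_connected G"
    and cycles: "\<And>c. cycle c \<Longrightarrow> awalk_cost f c \<ge> 0"
  obtains \<pi> :: "'a \<Rightarrow> real" where "\<And>u p v. awalk u p v \<Longrightarrow> \<pi> v \<le> \<pi> u + awalk_cost f p"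
proof -
  obtain r where r: "r \<in> verts G"
    using sc by (auto simp: strongly_connected_def)
  \<comment> \<open>Here \<open>\<mu> f r v\<close> is the infimum of walk costs from
    \<open>r\<close> to \<open>v\<close>, an extended real. Since no closed walk is negative, it is
    attained, and the cost of an optimal walk gives a real potential.\<close>
  have "\<exists>p. awalk r p v \<and> \<mu> f r v = awalk_cost f p" if "v \<in> verts G" for v
    using no_neg_cyc_reach_imp_path[of r v f] sc r that closed_awalk_cost_nonneg[of f] cycles
    by (force simp: strongly_connected_def apath_def not_less)
  then obtain p where p: "\<And>v. v \<in> verts G \<Longrightarrow> awalk r (p v) v"
    "\<And>v. v \<in> verts G \<Longrightarrow> \<mu> f r v = awalk_cost f (p v)"
    by metis
  show thesis
  proof (rule that)
    fix u q v assume q: "awalk u q v"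
    then have uv: "u \<in> verts G" "v \<in> verts G" by auto
    have "\<mu> f r v \<le> awalk_cost f (p u @ q)"
      using min_cost_le_walk_cost awalk_appendI p(1) q uv by blast
    then show "awalk_cost f (p v) \<le> awalk_cost f (p u) + awalk_cost f q"
      using p(2) uv by simp
  qed
qed

section \<open>Cycle means, path lengths and a bounded potential\<close>

lemma digraph_of_simps [simp]:
  "verts (digraph_of E) = UNIV" "arcs (digraph_of E) = E"
  "tail (digraph_of E) = fst" "head (digraph_of E) = snd"
  by (simp_all add: digraph_of_def)

lemma fin_digraph_digraph_of: "fin_digraph (digraph_of (E :: ('n::finite \<times> 'n) set))"
  by unfold_locales auto

lemma finite_cycle_means:
  fixes E :: "('n::finite \<times> 'n) set"
  shows "finite {sum_list (map w \<sigma>) / real (length \<sigma>) | \<sigma>. pre_digraph.cycle (digraph_of E) \<sigma>}"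
proof -
  interpret fin_digraph "digraph_of E" by (rule fin_digraph_digraph_of)
  have "{\<sigma>. cycle \<sigma>} \<subseteq> {\<sigma>. set \<sigma> \<subseteq> E \<and> distinct \<sigma>}"
    by (auto simp: cycle_conv awalk_def)
  then have "finite {\<sigma>. cycle \<sigma>}"
    using finite_subset finite_subset_distinct[of E] by auto
  then show ?thesis by simp
qed

text \<open>An edge followed by a walk back to its tail is closed and so contains a cycle.
  \<open>E \<noteq> {}\<close> excludes the single vertex without a loop.\<close>

lemma ex_cycle_if_strongly_connected:
  assumes sc: "strongly_connected (digraph_of E)" and "E \<noteq> {}"
  shows "\<exists>\<sigma>. pre_digraph.cycle (digraph_of (E :: ('n::finite \<times> 'n) set)) \<sigma>"
proof -
  interpret fin_digraph "digraph_of E" by (rule fin_digraph_digraph_of)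
  obtain u v where uv: "(u, v) \<in> E" using \<open>E \<noteq> {}\<close> by auto
  obtain p where "awalk v p u"
    using sc by (auto simp: strongly_connected_def reachable_awalk)
  then have "closed_w ((u, v) # p)"
    using uv by (auto simp: closed_w_def awalk_Cons_iff)
  then show ?thesis by (rule closed_w_imp_cycle)
qed

lemma min_mean_cycle_le:
  fixes E :: "('n::finite \<times> 'n) set"
  assumes "pre_digraph.cycle (digraph_of E) \<sigma>"
  shows "min_mean_cycle E w \<le> sum_list (map w \<sigma>) / real (length \<sigma>)"
  unfolding min_mean_cycle_def using assms by (intro Min_le finite_cycle_means) auto

lemma min_mean_cycle_attained:
  fixes E :: "('n::finite \<times> 'n) set"
  assumes "strongly_connected (digraph_of E)" "E \<noteq> {}"
  obtains \<sigma> where "pre_digraph.cycle (digraph_of E) \<sigma>"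
    "min_mean_cycle E w = sum_list (map w \<sigma>) / real (length \<sigma>)"
proof -
  have "min_mean_cycle E w \<in>
      {sum_list (map w \<sigma>) / real (length \<sigma>) | \<sigma>. pre_digraph.cycle (digraph_of E) \<sigma>}"
    unfolding min_mean_cycle_def
    using ex_cycle_if_strongly_connected[OF assms] by (intro Min_in finite_cycle_means) auto
  then show thesis using that by blast
qed

lemma path_dist_le_unweighted_diameter:
  "path_dist E u v \<le> unweighted_diameter (E :: ('n::finite \<times> 'n) set)"
proof -
  have "{path_dist E u v | u v. True} = (\<lambda>(u, v). path_dist E u v) ` UNIV" by auto
  then have "finite {path_dist E u v | u v. True}" by simp
  then show ?thesis unfolding unweighted_diameter_def by (intro Max_ge) auto
qed

text \<open>Strong connectivity makes the set under \<open>LEAST\<close> nonempty, so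
  \<open>path_dist\<close> is the length of an actual path.\<close>

lemma ex_awalk_length_le_diameter:
  fixes E :: "('n::finite \<times> 'n) set"
  assumes "strongly_connected (digraph_of E)"
  obtains p where "pre_digraph.awalk (digraph_of E) u p v" "length p \<le> unweighted_diameter E"
proof -
  interpret fin_digraph "digraph_of E" by (rule fin_digraph_digraph_of)
  have "\<exists>k p. apath u p v \<and> length p = k"
    using assms by (auto simp: strongly_connected_def reachable_apath)
  then have "\<exists>p. apath u p v \<and> length p = path_dist E u v"
    unfolding path_dist_def by (rule LeastI_ex)
  then show thesis
    using that path_dist_le_unweighted_diameter[of E u v] by (auto simp: apath_def)
qed

lemma min_mean_cycle_ge:
  fixes E :: "('n::finite \<times> 'n) set"
  assumes "strongly_connected (digraph_of E)" "E \<noteq> {}" "\<And>e. e \<in> E \<Longrightarrow> b \<le> w e"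
  shows "b \<le> min_mean_cycle E w"
proof -
  interpret fin_digraph "digraph_of E" by (rule fin_digraph_digraph_of)
  obtain \<sigma> where \<sigma>: "cycle \<sigma>" "min_mean_cycle E w = sum_list (map w \<sigma>) / real (length \<sigma>)"
    using min_mean_cycle_attained[OF assms(1,2)] .
  have "set \<sigma> \<subseteq> E" "\<sigma> \<noteq> []" using \<sigma>(1) by (auto simp: cycle_def awalk_def)
  then have "sum_list (map (\<lambda>_. b) \<sigma>) \<le> sum_list (map w \<sigma>)"
    using assms(3) by (intro sum_list_mono) auto
  then show ?thesis
    using \<sigma>(2) \<open>\<sigma> \<noteq> []\<close> by (simp add: sum_list_triv pos_le_divide_eq mult.commute)
qed

lemma bounded_potential:
  fixes E :: "('n::finite \<times> 'n) set"
  assumes sc: "strongly_connected (digraph_of E)" and ne: "E \<noteq> {}"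
    and w: "\<And>e. e \<in> E \<Longrightarrow> w e \<in> {- w_max .. w_max}"
  obtains \<pi> :: "'n \<Rightarrow> real"
  where "\<And>i j. (i, j) \<in> E \<Longrightarrow> \<pi> j \<le> \<pi> i + (w (i, j) - min_mean_cycle E w)"
    and "\<And>i. \<bar>\<pi> i\<bar> \<le> 2 * real (unweighted_diameter E) * w_max"
proof -
  interpret fin_digraph "digraph_of E" by (rule fin_digraph_digraph_of)
  define f where "f e = w e - min_mean_cycle E w" for e
  have cost: "awalk_cost f p = sum_list (map w p) - real (length p) * min_mean_cycle E w" for p
    by (induction p) (auto simp: f_def algebra_simps)
  have "awalk_cost f c \<ge> 0" if "cycle c" for c
    using min_mean_cycle_le[of E c w] that
    by (auto simp: cost cycle_def field_simps)
  then obtain \<pi> where \<pi>: "\<And>u p v. awalk u p v \<Longrightarrow> \<pi> v \<le> \<pi> u + awalk_cost f p"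
    using feasible_potential[OF sc] by metis
  obtain e where "e \<in> E" using ne by blast
  then have wmax: "w_max \<ge> 0" using w[of e] by auto
  \<comment> \<open>The factor 2 arises from \<open>w e \<le> w_max\<close> together with the cycle
    mean being at least \<open>- w_max\<close>.\<close>
  have f_le: "f e \<le> 2 * w_max" if "e \<in> E" for e
    using w[OF that] min_mean_cycle_ge[OF sc ne, of "- w_max" w] w by (force simp: f_def)
  have osc: "\<pi> v \<le> \<pi> u + 2 * real (unweighted_diameter E) * w_max" for u v
  proof -
    obtain p where p: "awalk u p v" "length p \<le> unweighted_diameter E"
      using ex_awalk_length_le_diameter[OF sc] .
    have "set p \<subseteq> E" using p(1) by (simp add: awalk_def)
    then have "awalk_cost f p \<le> real (length p) * (2 * w_max)"
      using f_le by (induction p) (auto simp: algebra_simps add_mono)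
    also have "\<dots> \<le> real (unweighted_diameter E) * (2 * w_max)"
      using p(2) wmax by (intro mult_right_mono) auto
    finally show ?thesis using \<pi>[OF p(1)] by simp
  qed
  \<comment> \<open>Only differences of \<open>\<pi>\<close> enter the edge inequality, so it may be
    shifted to have minimum 0. Its absolute values are then bounded by its oscillation.\<close>
  obtain r where r: "\<And>v. \<pi> r \<le> \<pi> v"
    using ex_min_if_finite[of "range \<pi>"] by (auto simp: not_less)
  show thesis
  proof (rule that)
    fix i j assume "(i, j) \<in> E"
    then have "awalk i [(i, j)] j" by (simp add: awalk_Cons_iff awalk_Nil_iff)
    from \<pi>[OF this] show "\<pi> j - \<pi> r \<le> \<pi> i - \<pi> r + (w (i, j) - min_mean_cycle E w)"
      by (simp add: f_def)
  next
    fix i show "\<bar>\<pi> i - \<pi> r\<bar> \<le> 2 * real (unweighted_diameter E) * w_max"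
      using r[of i] osc[of i r] by simp
  qed
qed

section \<open>The lower bound on the pairing by duality\<close>

lemma imbalance_eq:
  "imbalance P = (\<Sum>i\<in>UNIV. \<bar>(\<Sum>j\<in>UNIV. P $ i $ j) - (\<Sum>j\<in>UNIV. P $ j $ i)\<bar>)"
  by (simp add: imbalance_def l1_norm_def matrix_vector_mult_def transpose_def)

lemma imbalance_nonneg: "imbalance P \<ge> 0"
  by (simp add: imbalance_eq sum_nonneg)

text \<open>Entries outside \<open>E\<close> vanish. This passes from the sum over edges in the
  pairing to the row and column sums in the imbalance.\<close>

lemma sum_edges_eq:
  assumes "P \<in> edge_simplex E"
  shows "(\<Sum>(i, j)\<in>E. P $ i $ j * g i j) = (\<Sum>i\<in>UNIV. \<Sum>j\<in>UNIV. P $ i $ j * g i j)"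
proof -
  have "(\<Sum>(i, j)\<in>E. P $ i $ j * g i j) = (\<Sum>(i, j)\<in>UNIV \<times> UNIV. P $ i $ j * g i j)"
    using assms by (intro sum.mono_neutral_left) (force simp: edge_simplex_def)+
  then show ?thesis by (simp add: sum.cartesian_product)
qed

text \<open>Summation by parts: exchanging the two sums collects the terms \<open>\<pi> j\<close> at
  their vertex, where they meet the inflow.\<close>

lemma sum_potential_difference:
  fixes P :: "real ^ 'n ^ 'n::finite" and \<pi> :: "'n \<Rightarrow> real"
  shows "(\<Sum>i\<in>UNIV. \<Sum>j\<in>UNIV. P $ i $ j * (\<pi> i - \<pi> j))
    = (\<Sum>i\<in>UNIV. \<pi> i * ((\<Sum>j\<in>UNIV. P $ i $ j) - (\<Sum>j\<in>UNIV. P $ j $ i)))"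
proof -
  have "(\<Sum>i\<in>UNIV. \<Sum>j\<in>UNIV. P $ i $ j * \<pi> j) = (\<Sum>i\<in>UNIV. \<Sum>j\<in>UNIV. P $ j $ i * \<pi> i)"
    by (rule sum.swap)
  then show ?thesis
    by (simp add: algebra_simps sum_subtractf sum_distrib_left)
qed

text \<open>Weak linear programming duality, with \<open>\<pi>\<close> and the cycle mean as dual
  solution. As \<open>P\<close> need not be a circulation, the potential terms do not cancel;
  Hoelder's inequality bounds them by the maximum of \<open>\<bar>\<pi>\<bar>\<close> times the
  imbalance.\<close>

lemma min_mean_cycle_le_edge_pairing:
  fixes E :: "('n::finite \<times> 'n) set"
  assumes sc: "strongly_connected (digraph_of E)"
    and w: "\<And>e. e \<in> E \<Longrightarrow> w e \<in> {- w_max .. w_max}"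
    and P: "P \<in> edge_simplex E"
  shows "min_mean_cycle E w
    \<le> edge_pairing E w P + 2 * real (unweighted_diameter E) * w_max * imbalance P"
proof -
  let ?\<mu> = "min_mean_cycle E w" and ?M = "2 * real (unweighted_diameter E) * w_max"
  have "E \<noteq> {}" using P by (auto simp: edge_simplex_def)
  obtain \<pi> :: "'n \<Rightarrow> real" where \<pi>: "\<And>i j. (i, j) \<in> E \<Longrightarrow> \<pi> j \<le> \<pi> i + (w (i, j) - ?\<mu>)"
    and bound: "\<And>i. \<bar>\<pi> i\<bar> \<le> ?M"
    using bounded_potential[where w = w, OF sc \<open>E \<noteq> {}\<close> w] by blast
  have P_nonneg: "P $ i $ j \<ge> 0" for i j
    using P by (simp add: edge_simplex_def)
  have "?\<mu> - edge_pairing E w P = (\<Sum>(i, j)\<in>E. P $ i $ j * (?\<mu> - w (i, j)))"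
  proof -
    have "(\<Sum>(i, j)\<in>E. P $ i $ j * ?\<mu>) = ?\<mu>"
      using P by (simp add: sum_edges_eq[OF P] edge_simplex_def flip: sum_distrib_right)
    then show ?thesis
      by (simp add: edge_pairing_def right_diff_distrib sum_subtractf split_def)
  qed
  also have "\<dots> \<le> (\<Sum>(i, j)\<in>E. P $ i $ j * (\<pi> i - \<pi> j))"
    using \<pi> P_nonneg by (intro sum_mono) (force intro!: mult_left_mono)
  also have "\<dots> = (\<Sum>i\<in>UNIV. \<pi> i * ((\<Sum>j\<in>UNIV. P $ i $ j) - (\<Sum>j\<in>UNIV. P $ j $ i)))"
    by (simp only: sum_edges_eq[OF P] sum_potential_difference)
  also have "\<dots> \<le> (\<Sum>i\<in>UNIV. ?M * \<bar>(\<Sum>j\<in>UNIV. P $ i $ j) - (\<Sum>j\<in>UNIV. P $ j $ i)\<bar>)"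
  proof (rule sum_mono)
    fix i
    show "\<pi> i * ((\<Sum>j\<in>UNIV. P $ i $ j) - (\<Sum>j\<in>UNIV. P $ j $ i))
      \<le> ?M * \<bar>(\<Sum>j\<in>UNIV. P $ i $ j) - (\<Sum>j\<in>UNIV. P $ j $ i)\<bar>"
      using mult_right_mono[OF bound[of i], of "\<bar>(\<Sum>j\<in>UNIV. P $ i $ j) - (\<Sum>j\<in>UNIV. P $ j $ i)\<bar>"]
      by (simp flip: abs_mult)
  qed
  also have "\<dots> = ?M * imbalance P"
    by (simp add: imbalance_eq sum_distrib_left)
  finally show ?thesis by simp
qed

section \<open>Closed walks as balanced points of the simplex\<close>

definition edge_frequency :: "('n \<times> 'n) list \<Rightarrow> real ^ 'n ^ 'n::finite" where
  "edge_frequency \<sigma> = (\<chi> i j. real (count_list \<sigma> (i, j)) / real (length \<sigma>))"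

text \<open>Used with the constant \<open>1 / real (length \<sigma>)\<close> for the total mass and
  with \<open>w\<close> for the cost.\<close>

lemma sum_count_list_mult:
  fixes g :: "'a \<Rightarrow> real"
  assumes "finite A" "set \<sigma> \<subseteq> A"
  shows "(\<Sum>e\<in>A. real (count_list \<sigma> e) * g e) = sum_list (map g \<sigma>)"
  using assms(2)
proof (induction \<sigma>)
  case (Cons a \<sigma>)
  have "(\<Sum>e\<in>A. real (count_list (a # \<sigma>) e) * g e)
      = (\<Sum>e\<in>A. (if a = e then g e else 0) + real (count_list \<sigma> e) * g e)"
    by (intro sum.cong) (auto simp: algebra_simps)
  then show ?case
    using Cons assms(1) by (simp add: sum.distrib)
qed simp

lemma edge_frequency_in_edge_simplex:
  assumes "set \<sigma> \<subseteq> E" "\<sigma> \<noteq> []"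
  shows "edge_frequency \<sigma> \<in> edge_simplex E"
proof -
  have "(\<Sum>i\<in>UNIV. \<Sum>j\<in>UNIV. edge_frequency \<sigma> $ i $ j)
      = (\<Sum>e\<in>UNIV. real (count_list \<sigma> e) * (1 / real (length \<sigma>)))"
    by (simp add: edge_frequency_def sum.cartesian_product split_def)
  also have "\<dots> = 1"
    using assms(2) by (subst sum_count_list_mult) (simp_all add: sum_list_triv)
  finally show ?thesis
    using assms(1) by (auto simp: edge_simplex_def edge_frequency_def count_list_0_iff)
qed

lemma edge_pairing_edge_frequency:
  fixes E :: "('n::finite \<times> 'n) set"
  assumes "set \<sigma> \<subseteq> E"
  shows "edge_pairing E w (edge_frequency \<sigma>) = sum_list (map w \<sigma>) / real (length \<sigma>)"
proof -
  have "edge_pairing E w (edge_frequency \<sigma>)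
      = (\<Sum>e\<in>E. real (count_list \<sigma> e) * w e) / real (length \<sigma>)"
    by (simp add: edge_pairing_def edge_frequency_def split_def sum_divide_distrib)
  then show ?thesis using sum_count_list_mult[of E \<sigma> w] assms by simp
qed

text \<open>The induction removes the first edge, so it needs arbitrary end vertices. The
  \<open>of_bool\<close> terms record the unit of flow that leaves \<open>u\<close> and arrives at
  \<open>v\<close>; they cancel for a closed walk.\<close>

lemma awalk_flow_conservation:
  fixes E :: "('n::finite \<times> 'n) set"
  assumes "pre_digraph.awalk (digraph_of E) u p v"
  shows "(\<Sum>j\<in>UNIV. real (count_list p (i, j))) + of_bool (i = v)
    = (\<Sum>j\<in>UNIV. real (count_list p (j, i))) + of_bool (i = u)"
proof -
  interpret fin_digraph "digraph_of E" by (rule fin_digraph_digraph_of)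
  show ?thesis using assms
  proof (induction p arbitrary: u)
    case Nil
    then show ?case by (simp add: awalk_Nil_iff)
  next
    case (Cons e p)
    obtain x y where e: "e = (x, y)" by fastforce
    then have "x = u" and p: "awalk y p v" using Cons.prems by (auto simp: awalk_Cons_iff)
    have "(\<Sum>j\<in>UNIV. real (count_list (e # p) (i, j)))
        = (\<Sum>j\<in>UNIV. (if y = j then of_bool (i = u) else 0) + real (count_list p (i, j)))"
      using e \<open>x = u\<close> by (intro sum.cong) auto
    moreover have "(\<Sum>j\<in>UNIV. real (count_list (e # p) (j, i)))
        = (\<Sum>j\<in>UNIV. (if x = j then of_bool (i = y) else 0) + real (count_list p (j, i)))"
      using e by (intro sum.cong) auto
    ultimately show ?case
      using Cons.IH[OF p] by (simp add: sum.distrib)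
  qed
qed

lemma imbalance_edge_frequency_closed:
  fixes E :: "('n::finite \<times> 'n) set"
  assumes "pre_digraph.awalk (digraph_of E) u \<sigma> u"
  shows "imbalance (edge_frequency \<sigma>) = 0"
  using awalk_flow_conservation[OF assms]
  by (simp add: imbalance_eq edge_frequency_def flip: sum_divide_distrib)

section \<open>Comparison with an optimal cycle\<close>

theorem theorem6p1:
  fixes E :: "('n::finite \<times> 'n) set"
    and w :: "('n \<times> 'n) weight_fun"
    and w_max eps :: real
    and P :: "real ^ 'n ^ 'n"
  assumes "strongly_connected (digraph_of E)"
    and "\<And>e. e \<in> E \<Longrightarrow> w e \<in> {- w_max .. w_max}"
    and "eps > 0"
    and "P \<in> edge_simplex E"
    and "suboptimal (edge_simplex E) (penalized_objective E w w_max) eps P"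
  shows "edge_pairing E w P \<le> min_mean_cycle E w + eps
    \<and> (real (unweighted_diameter E) * w_max \<noteq> 0 \<longrightarrow>
         imbalance P \<le> eps / (real (unweighted_diameter E) * w_max))"
proof -
  interpret fin_digraph "digraph_of E" by (rule fin_digraph_digraph_of)
  let ?\<mu> = "min_mean_cycle E w" and ?d = "real (unweighted_diameter E)"
  note sc = assms(1) and w = assms(2) and P = assms(4)
  have "E \<noteq> {}" using P by (auto simp: edge_simplex_def)
  \<comment> \<open>A single edge suffices for the sign: the interval containing \<open>w e\<close>
    is nonempty, so \<open>w_max \<ge> 0\<close>.\<close>
  then obtain e where "e \<in> E" by blast
  then have dw: "?d * w_max \<ge> 0" using w[of e] by auto
  have lower: "?\<mu> + ?d * w_max * imbalance Q \<le> penalized_objective E w w_max Q"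
    if "Q \<in> edge_simplex E" for Q
    using min_mean_cycle_le_edge_pairing[where w = w, OF sc w that]
    by (simp add: penalized_objective_def algebra_simps)
  \<comment> \<open>On the reals, \<open>INF\<close> is known to be a lower bound only for sets
    bounded below; the duality bound supplies this for \<open>cINF_lower\<close>.\<close>
  have "bdd_below (penalized_objective E w w_max ` edge_simplex E)"
  proof (rule bdd_belowI2)
    fix Q assume "Q \<in> edge_simplex E"
    then show "?\<mu> \<le> penalized_objective E w w_max Q"
      using lower[of Q] mult_nonneg_nonneg[OF dw imbalance_nonneg[of Q]] by linarith
  qed
  moreover obtain \<sigma> where \<sigma>: "cycle \<sigma>" "?\<mu> = sum_list (map w \<sigma>) / real (length \<sigma>)"
    using min_mean_cycle_attained[OF sc \<open>E \<noteq> {}\<close>] .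
  then obtain u where u: "awalk u \<sigma> u" "\<sigma> \<noteq> []" "set \<sigma> \<subseteq> E" by (auto simp: cycle_def awalk_def)
  ultimately have "(INF Q\<in>edge_simplex E. penalized_objective E w w_max Q)
      \<le> penalized_objective E w w_max (edge_frequency \<sigma>)"
    by (intro cINF_lower edge_frequency_in_edge_simplex)
  also have "\<dots> = ?\<mu>"
    using u \<sigma>(2)
    by (simp add: penalized_objective_def edge_pairing_edge_frequency
        imbalance_edge_frequency_closed)
  finally have obj: "penalized_objective E w w_max P \<le> ?\<mu> + eps"
    using assms(5) by (simp add: suboptimal_def)
  have "edge_pairing E w P \<le> ?\<mu> + eps"
    using obj mult_nonneg_nonneg[OF dw imbalance_nonneg[of P]]
    by (simp add: penalized_objective_def)
  \<comment> \<open>The guard matters because division by 0 yields 0: for \<open>w_max = 0\<close>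
    the objective vanishes on the simplex and cannot force the imbalance to be 0.\<close>
  moreover have "imbalance P \<le> eps / (?d * w_max)" if "?d * w_max \<noteq> 0"
  proof -
    have "?d * w_max > 0" using dw that by linarith
    moreover have "imbalance P * (?d * w_max) \<le> eps"
      using lower[OF P] obj by (simp add: mult.commute)
    ultimately show ?thesis by (simp add: pos_le_divide_eq)
  qed
  ultimately show ?thesis by blast
qed

end
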